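(* Let $\Lambda$ be a finite set with more than one element, $X=\Lambda^{\mathbb{Z}}$, $\sigma$ the shift on $X$, and $\mu=\prod_{\mathbb{Z}}\mu_1$, where $\mu_1$ is a probability measure on $\Lambda$ with $\mu_1(\{\lambda\})>0$ for all $\lambda\in\Lambda$. Let $n>1$ be an integer, $C_1$ a non-empty proper subset of $\Lambda$, $C=\{x\in X: x_0\in C_1\}$ and $D=X\setminus C$. For $\lambda=(\lambda_1,\lambda_2)$ with $\lambda_1,\lambda_2\in\mathbb{C}$, $|\lambda_1|=|\lambda_2|=1$, define $W(\lambda)=\chi_C\otimes\lambda_1u^*+\chi_D\otimes\lambda_2v^*\in L^\infty(X,\mu)\otimes M_n$. Let $\lambda=(\lambda_1,\lambda_2)$ and $\lambda'=(\lambda_1',\lambda_2')$ be two such pairs. Then $W(\lambda)V$ is unitarily equivalent to $W(\lambda')V$ if and only if $\lambda_1^n=(\lambda_1')^n$ and $\lambda_2^n=(\lambda_2')^n$.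
   Context: $\sigma$ is the shift to the right, $\sigma(x)_i=x_{i-1}$. $V$ is the unitary on $L^2(X,\mu)$ given by $(V\xi)(x)=\xi(\sigma^{-1}(x))$, and $V$ also denotes $V\otimes1$ on $L^2(X,\mu)\otimes\mathbb{C}^n$. $M_n$ is the algebra of complex $n\times n$ matrices, $\omega=e^{2\pi i/n}$, $u=\mathrm{diag}(1,\omega,\dots,\omega^{n-1})$, and $v\in M_n$ is the cyclic shift permutation unitary with $vuv^*=\omega u$. $\chi_S$ is the characteristic function of $S$. "$W(\lambda)V$ is unitarily equivalent to $W(\lambda')V$" means that there is a unitary $\zeta\in L^\infty(X,\mu)\otimes M_n$ with $W(\lambda)V=\zeta W(\lambda')V\zeta^*$. *)

theory Defs
  imports "HOL-Probability.Probability" "Jordan_Normal_Form.Schur_Decomposition"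
begin

section \<open>The Bernoulli shift\<close>

definition seq_space :: "'l set \<Rightarrow> (int \<Rightarrow> 'l) set" where
  "seq_space L = (UNIV :: int set) \<rightarrow>\<^sub>E L"

definition bernoulli :: "'l measure \<Rightarrow> (int \<Rightarrow> 'l) measure" where
  "bernoulli \<mu>1 = PiM (UNIV :: int set) (\<lambda>_. \<mu>1)"

definition shift :: "(int \<Rightarrow> 'l) \<Rightarrow> (int \<Rightarrow> 'l)" where
  "shift x = (\<lambda>i. x (i - 1))"

lemma bij_shift: "bij shift"
  by (rule o_bij[where g = "\<lambda>x i. x (i + 1)"]) (auto simp: shift_def fun_eq_iff)

lemma inv_shift: "inv_into UNIV shift x = (\<lambda>i. x (i + 1))"
  by (rule inv_f_eq[OF bij_is_inj[OF bij_shift]]) (simp add: shift_def)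

definition cyl :: "'l set \<Rightarrow> 'l set \<Rightarrow> (int \<Rightarrow> 'l) set" where
  "cyl L C1 = {x \<in> seq_space L. x 0 \<in> C1}"


section \<open>The matrices \<open>u\<close> and \<open>v\<close>\<close>

definition \<omega> :: "nat \<Rightarrow> complex" where
  "\<omega> n = exp (2 * of_real pi * \<i> / of_nat n)"

definition u_mat :: "nat \<Rightarrow> complex mat" where
  "u_mat n = Matrix.mat n n (\<lambda>(i, j). if i = j then \<omega> n ^ i else 0)"

text \<open>The direction of the cyclic shift is the one forced by \<open>v u v\<^sup>* = \<omega> u\<close>: on the standard
  basis, \<open>v e\<^sub>j = e\<^bsub>j - 1\<^esub>\<close> with indices modulo \<open>n\<close>.\<close>

definition v_mat :: "nat \<Rightarrow> complex mat" where
  "v_mat n = Matrix.mat n n (\<lambda>(i, j). if j = (i + 1) mod n then 1 else 0)"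


section \<open>The algebra \<open>L\<^sup>\<infinity>(M) \<otimes> M\<^sub>n\<close> and the Hilbert space \<open>L\<^sup>2(M) \<otimes> \<complex>\<^sup>n\<close>\<close>

text \<open>\<open>L\<^sup>\<infinity>(M) \<otimes> M\<^sub>n\<close> and \<open>L\<^sup>2(M) \<otimes> \<complex>\<^sup>n\<close> are represented by their matrix-valued, respectively
  vector-valued, representatives; equality of elements is equality almost everywhere.\<close>

definition Linf_mat :: "'x measure \<Rightarrow> nat \<Rightarrow> ('x \<Rightarrow> complex mat) set" where
  "Linf_mat M n = {F. (\<forall>x \<in> space M. F x \<in> carrier_mat n n) \<and>
     (\<forall>i<n. \<forall>j<n. (\<lambda>x. F x $$ (i, j)) \<in> borel_measurable M) \<and>
     (\<exists>B. AE x in M. \<forall>i<n. \<forall>j<n. cmod (F x $$ (i, j)) \<le> B)}"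

definition L2_vec :: "'x measure \<Rightarrow> nat \<Rightarrow> ('x \<Rightarrow> complex Matrix.vec) set" where
  "L2_vec M n = {\<xi>. (\<forall>x \<in> space M. \<xi> x \<in> carrier_vec n) \<and>
     (\<forall>i<n. (\<lambda>x. vec_index (\<xi> x) i) \<in> borel_measurable M \<and>
            integrable M (\<lambda>x. (cmod (vec_index (\<xi> x) i))\<^sup>2))}"

definition unitary_Linf :: "'x measure \<Rightarrow> nat \<Rightarrow> ('x \<Rightarrow> complex mat) \<Rightarrow> bool" where
  "unitary_Linf M n \<zeta> \<longleftrightarrow> \<zeta> \<in> Linf_mat M n \<and>
     (AE x in M. \<zeta> x * mat_adjoint (\<zeta> x) = 1\<^sub>m n \<and> mat_adjoint (\<zeta> x) * \<zeta> x = 1\<^sub>m n)"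

definition tensor :: "('x \<Rightarrow> complex) \<Rightarrow> complex mat \<Rightarrow> 'x \<Rightarrow> complex mat" where
  "tensor f A = (\<lambda>x. f x \<cdot>\<^sub>m A)"

definition mult_op ::
  "('x \<Rightarrow> complex mat) \<Rightarrow> ('x \<Rightarrow> complex Matrix.vec) \<Rightarrow> ('x \<Rightarrow> complex Matrix.vec)" where
  "mult_op F \<xi> = (\<lambda>x. F x *\<^sub>v \<xi> x)"

definition V_op ::
  "((int \<Rightarrow> 'l) \<Rightarrow> complex Matrix.vec) \<Rightarrow> ((int \<Rightarrow> 'l) \<Rightarrow> complex Matrix.vec)" where
  "V_op \<xi> = (\<lambda>x. \<xi> (inv_into UNIV shift x))"

definition op_eq :: "'x measure \<Rightarrow> nat \<Rightarrow>
    (('x \<Rightarrow> complex Matrix.vec) \<Rightarrow> ('x \<Rightarrow> complex Matrix.vec)) \<Rightarrow>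
    (('x \<Rightarrow> complex Matrix.vec) \<Rightarrow> ('x \<Rightarrow> complex Matrix.vec)) \<Rightarrow> bool" where
  "op_eq M n S T \<longleftrightarrow> (\<forall>\<xi> \<in> L2_vec M n. AE x in M. S \<xi> x = T \<xi> x)"


section \<open>The operators \<open>W(\<lambda>)V\<close>\<close>

definition W :: "nat \<Rightarrow> 'l set \<Rightarrow> 'l set \<Rightarrow> complex \<times> complex \<Rightarrow> (int \<Rightarrow> 'l) \<Rightarrow> complex mat" where
  "W n L C1 l = (\<lambda>x.
     tensor (indicator (cyl L C1)) (fst l \<cdot>\<^sub>m mat_adjoint (u_mat n)) x +
     tensor (indicator (seq_space L - cyl L C1)) (snd l \<cdot>\<^sub>m mat_adjoint (v_mat n)) x)"

definition unitarily_equiv ::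
  "(int \<Rightarrow> 'l) measure \<Rightarrow> nat \<Rightarrow> ((int \<Rightarrow> 'l) \<Rightarrow> complex mat) \<Rightarrow> ((int \<Rightarrow> 'l) \<Rightarrow> complex mat) \<Rightarrow> bool"
where
  "unitarily_equiv M n F G \<longleftrightarrow> (\<exists>\<zeta>. unitary_Linf M n \<zeta> \<and>
     op_eq M n (mult_op F \<circ> V_op)
       (mult_op \<zeta> \<circ> (mult_op G \<circ> V_op) \<circ> mult_op (\<lambda>x. mat_adjoint (\<zeta> x))))"

section \<open>Consistency checks\<close>

lemma dim_adjoint [simp]:
  "dim_row (mat_adjoint A) = dim_col A" "dim_col (mat_adjoint A) = dim_row A"
  by (simp_all add: mat_adjoint_def)

lemma index_adjoint:
  assumes "i < dim_col A" "j < dim_row A"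
  shows "mat_adjoint A $$ (i, j) = conjugate (A $$ (j, i))"
  using assms by (simp add: mat_adjoint_def mat_of_rows_def)

lemma omega_power_n:
  assumes "n > 0"
  shows "\<omega> n ^ n = 1"
  using assms by (simp add: \<omega>_def flip: exp_of_nat_mult)

lemma omega_power_mod:
  assumes "n > 0"
  shows "\<omega> n ^ (k mod n) = \<omega> n ^ k"
proof -
  have "\<omega> n ^ k = \<omega> n ^ (n * (k div n) + k mod n)" by simp
  also have "\<dots> = \<omega> n ^ (k mod n)"
    unfolding power_add power_mult using omega_power_n[OF assms] by simp
  finally show ?thesis by simp
qed

lemma Suc_mod_inj:
  assumes "i < n" "j < n" "Suc i mod n = Suc j mod n"
  shows "i = j"
  using assms by (auto simp: mod_Suc split: if_splits)

lemma v_unitary: "v_mat n * mat_adjoint (v_mat n) = 1\<^sub>m n"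
proof (rule eq_matI)
  fix i j assume "i < dim_row (1\<^sub>m n :: complex mat)" "j < dim_col (1\<^sub>m n :: complex mat)"
  then have ij: "i < n" "j < n" by auto
  have "(v_mat n * mat_adjoint (v_mat n)) $$ (i, j) =
        (\<Sum>k<n. (if k = Suc i mod n then 1 else 0) * (if k = Suc j mod n then 1 else 0))"
    using ij by (auto simp: v_mat_def scalar_prod_def index_adjoint atLeast0LessThan intro!: sum.cong)
  also have "\<dots> = (\<Sum>k<n. if k = Suc i mod n then (if k = Suc j mod n then 1 else 0) else 0)"
    by (intro sum.cong) auto
  also have "\<dots> = (if i = j then 1 else 0)"
    using ij by (auto simp: sum.delta dest: Suc_mod_inj)
  finally show "(v_mat n * mat_adjoint (v_mat n)) $$ (i, j) = 1\<^sub>m n $$ (i, j)"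
    using ij by simp
qed (auto simp: v_mat_def)

lemma v_u_commute: "v_mat n * u_mat n = \<omega> n \<cdot>\<^sub>m (u_mat n * v_mat n)"
proof (rule eq_matI)
  fix i j assume "i < dim_row (\<omega> n \<cdot>\<^sub>m (u_mat n * v_mat n))" "j < dim_col (\<omega> n \<cdot>\<^sub>m (u_mat n * v_mat n))"
  then have ij: "i < n" "j < n" by (auto simp: u_mat_def v_mat_def)
  have "(v_mat n * u_mat n) $$ (i, j) =
      (\<Sum>k<n. (if k = Suc i mod n then 1 else 0) * (if k = j then \<omega> n ^ k else 0))"
    using ij by (simp add: u_mat_def v_mat_def scalar_prod_def atLeast0LessThan)
  also have "\<dots> = (\<Sum>k<n. if k = j then (if k = Suc i mod n then \<omega> n ^ k else 0) else 0)"
    by (intro sum.cong) auto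
  also have "\<dots> = (if j = Suc i mod n then \<omega> n ^ j else 0)" using ij by (simp add: sum.delta)
  also have "\<dots> = (if j = Suc i mod n then \<omega> n * \<omega> n ^ i else 0)"
    using ij omega_power_mod[of n "Suc i"] by auto
  also have "\<dots> = \<omega> n * (\<Sum>k<n. if k = i then (if j = Suc k mod n then \<omega> n ^ i else 0) else 0)"
    using ij by (simp add: sum.delta)
  also have "\<dots> = \<omega> n * (\<Sum>k<n. (if i = k then \<omega> n ^ i else 0) * (if j = Suc k mod n then 1 else 0))"
    by (intro arg_cong[where f = "(*) (\<omega> n)"] sum.cong) auto
  also have "\<dots> = (\<omega> n \<cdot>\<^sub>m (u_mat n * v_mat n)) $$ (i, j)"
    using ij by (simp add: u_mat_def v_mat_def scalar_prod_def atLeast0LessThan)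
  finally show "(v_mat n * u_mat n) $$ (i, j) = (\<omega> n \<cdot>\<^sub>m (u_mat n * v_mat n)) $$ (i, j)" .
qed (auto simp: u_mat_def v_mat_def)

lemma v_u_v_adjoint: "v_mat n * u_mat n * mat_adjoint (v_mat n) = \<omega> n \<cdot>\<^sub>m u_mat n"
proof -
  have c: "u_mat n \<in> carrier_mat n n" "v_mat n \<in> carrier_mat n n"
      "mat_adjoint (v_mat n) \<in> carrier_mat n n"
    by (auto simp: u_mat_def v_mat_def intro!: carrier_matI)
  have "v_mat n * u_mat n * mat_adjoint (v_mat n) =
        \<omega> n \<cdot>\<^sub>m (u_mat n * v_mat n * mat_adjoint (v_mat n))"
    unfolding v_u_commute using c by (intro mult_smult_assoc_mat) auto
  also have "u_mat n * v_mat n * mat_adjoint (v_mat n) = u_mat n"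
    using c by (simp add: assoc_mult_mat[OF c(1) c(2) c(3)] v_unitary)
  finally show ?thesis .
qed

end

theory Submission
  imports Defs
begin

text \<open>With \<open>\<tau> = \<sigma>\<^sup>-\<^sup>1\<close>, unitary equivalence by \<open>\<zeta>\<close> means \<open>W(\<lambda>)(x) \<zeta>(\<tau> x) = \<zeta>(x) W(\<lambda>')(x)\<close> almost everywhere.
  As \<open>W(\<lambda>)(x)\<close> depends on \<open>x\<^sub>0\<close> only, \<open>\<zeta>(x)\<close> and \<open>\<zeta>(\<tau>\<^sup>m x)\<close> determine each other through
  \<open>x\<^sub>0, \<dots>, x\<^bsub>m-1\<^esub>\<close>. Since \<open>\<zeta>\<close> is almost a function of finitely many coordinates, letting
  \<open>m \<rightarrow> \<infinity>\<close> shows that \<open>\<zeta>\<close> depends only on the coordinates \<open>i \<ge> 0\<close>, and running backwards that it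
  depends only on the coordinates \<open>i < 0\<close>. These are independent, so \<open>\<zeta>\<close> is constant, and
  determinants on \<open>C\<close> and on \<open>D\<close> give the two identities. Conversely, conjugation by the constants
  \<open>u\<close> and \<open>v\<close> multiplies \<open>\<lambda>\<^sub>2\<close>, respectively \<open>\<lambda>\<^sub>1\<close>, by an \<open>n\<close>-th root of unity generating all of
  them.\<close>

section \<open>Resampling coordinates of a product measure\<close>

text \<open>Boxes with finitely many constraints determine the measure. Coordinates are independent,
  so the mass of a box is the product of the masses of its constraints on \<open>K\<close> and off
  \<open>K\<close>, and it is the same whether these are read off one point or off two independent
  points.\<close>

lemma distr_override_on:
  fixes K :: "'i set"
  assumes "prob_space N"
  defines "M \<equiv> PiM (UNIV :: 'i set) (\<lambda>_. N)"
  shows "distr (M \<Otimes>\<^sub>M M) M (\<lambda>z. override_on (snd z) (fst z) K) = M"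
    and "(\<lambda>z. override_on (snd z) (fst z) K) \<in> M \<Otimes>\<^sub>M M \<rightarrow>\<^sub>M M"
proof -
  interpret N: prob_space N by fact
  interpret P: product_prob_space "\<lambda>_. N" "UNIV :: 'i set" by unfold_locales
  interpret M: prob_space M unfolding M_def by unfold_locales
  show meas: "(\<lambda>z. override_on (snd z) (fst z) K) \<in> M \<Otimes>\<^sub>M M \<rightarrow>\<^sub>M M"
    unfolding M_def
  proof (rule measurable_PiM_single')
    fix i :: 'i
    show "(\<lambda>z. override_on (snd z) (fst z) K i) \<in>
      PiM UNIV (\<lambda>_. N) \<Otimes>\<^sub>M PiM UNIV (\<lambda>_. N) \<rightarrow>\<^sub>M N"
      by (cases "i \<in> K") simp_all
  qed (auto simp: space_pair_measure space_PiM override_on_def PiE_iff)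
  show "distr (M \<Otimes>\<^sub>M M) M (\<lambda>z. override_on (snd z) (fst z) K) = M"
    unfolding M_def[symmetric]
  proof (rule measure_eqI_PiM_infinite)
    show "finite_measure (distr (M \<Otimes>\<^sub>M M) M (\<lambda>z. override_on (snd z) (fst z) K))"
      using meas by (intro finite_measure.finite_measure_distr)
        (auto intro!: prob_space.finite_measure prob_space_pair M.prob_space_axioms)
  next
    fix F and J :: "'i set"
    assume J: "finite J" "J \<subseteq> UNIV" and F: "\<And>i. i \<in> J \<Longrightarrow> F i \<in> sets N"
    let ?E = "\<lambda>J. prod_emb UNIV (\<lambda>_. N) J (Pi\<^sub>E J F)"
    have E: "?E J' \<in> sets M" if "J' \<subseteq> J" for J'
      using that J F unfolding M_def
      by (intro measurable_prod_emb sets_PiM_I_finite) (auto intro: finite_subset)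
    have emE: "emeasure M (?E J') = (\<Prod>i\<in>J'. emeasure N (F i))" if "J' \<subseteq> J" for J'
      using that J F unfolding M_def by (intro P.emeasure_PiM_emb) (auto intro: finite_subset)
    \<comment> \<open>The constraints with index in \<open>K\<close> see only the first point and
      the others only the second, so the preimage is a rectangle and its mass factors.\<close>
    have "(\<lambda>z. override_on (snd z) (fst z) K) -` ?E J \<inter> space (M \<Otimes>\<^sub>M M) = ?E (J \<inter> K) \<times> ?E (J - K)"
      by (auto simp: prod_emb_def space_pair_measure M_def space_PiM override_on_def PiE_iff
            split: if_splits)
    then have "emeasure (distr (M \<Otimes>\<^sub>M M) M (\<lambda>z. override_on (snd z) (fst z) K)) (?E J) =
      emeasure M (?E (J \<inter> K)) * emeasure M (?E (J - K))"
      using E meas by (simp add: emeasure_distr M.emeasure_pair_measure_Times)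
    also have "\<dots> = emeasure M (?E J)"
      using J by (simp add: emE prod.Int_Diff[of J _ K])
    finally show "emeasure (distr (M \<Otimes>\<^sub>M M) M (\<lambda>z. override_on (snd z) (fst z) K)) (?E J) =
      emeasure M (?E J)" .
  qed (simp_all add: M_def)
qed

text \<open>This replaces approximation by functions of finitely many coordinates. On a generator
  the maps \<open>T m\<close> and \<open>S\<close> eventually agree, and the property passes through
  a Dynkin system to all measurable sets, then to sums and L1 limits. Since \<open>T m\<close> and
  \<open>S\<close> all carry \<open>\<Omega>\<close> to \<open>M\<close>, replacing \<open>f\<close>
  by an approximant costs the same for every \<open>m\<close>, which makes the limits
  interchangeable.\<close>

lemma tendsto_L1_comp:
  fixes f :: "'b \<Rightarrow> 'c :: {banach, second_countable_topology}"
  assumes T: "\<And>m::nat. T m \<in> \<Omega> \<rightarrow>\<^sub>M M" "\<And>m. distr \<Omega> M (T m) = M"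
    and S: "S \<in> \<Omega> \<rightarrow>\<^sub>M M" "distr \<Omega> M S = M"
    and \<Omega>: "prob_space \<Omega>"
    and G: "Int_stable G" "G \<subseteq> Pow (space M)" "sets M = sigma_sets (space M) G"
    and ev: "\<And>A. A \<in> G \<Longrightarrow> \<forall>\<^sub>F m in sequentially. \<forall>z\<in>space \<Omega>. T m z \<in> A \<longleftrightarrow> S z \<in> A"
    and f: "integrable M f"
  shows "(\<lambda>m. \<integral>z. norm (f (T m z) - f (S z)) \<partial>\<Omega>) \<longlonglongrightarrow> 0"
proof -
  interpret \<Omega>: prob_space \<Omega> by fact
  interpret M: prob_space M
    using \<Omega>.prob_space_distr[OF S(1)] S(2) by simp
  define P where "P h \<longleftrightarrow> (\<lambda>m. \<integral>z. norm (h (T m z) - h (S z)) \<partial>\<Omega>) \<longlonglongrightarrow> 0"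
    for h :: "'b \<Rightarrow> 'c"
  have intT: "integrable \<Omega> (\<lambda>z. h (T m z))" if "integrable M h" for h :: "'b \<Rightarrow> 'c" and m
    using integrable_distr[of "T m" \<Omega> M h] T that by simp
  have intS: "integrable \<Omega> (\<lambda>z. h (S z))" if "integrable M h" for h :: "'b \<Rightarrow> 'c"
    using integrable_distr[of S \<Omega> M h] S that by simp
  have int: "integrable \<Omega> (\<lambda>z. norm (h (T m z) - h (S z)))"
    if "integrable M h" for h :: "'b \<Rightarrow> 'c" and m
    using intT intS that by auto
  have normT: "(\<integral>z. norm (h (T m z)) \<partial>\<Omega>) = (\<integral>x. norm (h x) \<partial>M)"
    if "integrable M h" for h :: "'b \<Rightarrow> 'c" and m
    using integral_distr[of "T m" \<Omega> M "\<lambda>x. norm (h x)"] T that by simp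
  have normS: "(\<integral>z. norm (h (S z)) \<partial>\<Omega>) = (\<integral>x. norm (h x) \<partial>M)"
    if "integrable M h" for h :: "'b \<Rightarrow> 'c"
    using integral_distr[of S \<Omega> M "\<lambda>x. norm (h x)"] S that by simp
  have addP: "P (\<lambda>x. g x + h x)" if gh: "integrable M g" "P g" "integrable M h" "P h" for g h
    unfolding P_def
  proof (rule tendsto_sandwich[OF _ _ tendsto_const])
    show "(\<lambda>m. (\<integral>z. norm (g (T m z) - g (S z)) \<partial>\<Omega>) + (\<integral>z. norm (h (T m z) - h (S z)) \<partial>\<Omega>)) \<longlonglongrightarrow> 0"
      using tendsto_add[of _ 0 sequentially _ 0] gh by (simp add: P_def)
    have "(\<integral>z. norm (g (T m z) + h (T m z) - (g (S z) + h (S z))) \<partial>\<Omega>)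
      \<le> (\<integral>z. norm (g (T m z) - g (S z)) + norm (h (T m z) - h (S z)) \<partial>\<Omega>)" for m
      using gh(1,3)
      by (intro integral_mono)
        (auto intro!: int intT intS norm_diff_triangle_ineq Bochner_Integration.integrable_add)
    then show "\<forall>\<^sub>F m in sequentially. (\<integral>z. norm (g (T m z) + h (T m z) - (g (S z) + h (S z))) \<partial>\<Omega>)
      \<le> (\<integral>z. norm (g (T m z) - g (S z)) \<partial>\<Omega>) + (\<integral>z. norm (h (T m z) - h (S z)) \<partial>\<Omega>)"
      using gh by (simp add: int)
  qed auto
  \<comment> \<open>The error of the approximant \<open>s k\<close> enters twice, once through
    \<open>T m\<close> and once through \<open>S\<close>. Both contributions equal its L1 distance
    to \<open>h\<close> under \<open>M\<close>, so e/4 for each leaves e/2 for \<open>s k\<close>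
    itself.\<close>
  have limP: "P h" if h: "integrable M h" and s: "\<And>k::nat. integrable M (s k)" "\<And>k. P (s k)"
    and conv: "(\<lambda>k. \<integral>x. norm (s k x - h x) \<partial>M) \<longlonglongrightarrow> 0" for h s
    unfolding P_def
  proof (rule LIMSEQ_I)
    fix e :: real assume "e > 0"
    then obtain k where k: "(\<integral>x. norm (s k x - h x) \<partial>M) < e / 4"
      using order_tendstoD(2)[OF conv, of "e/4"] by (auto simp: eventually_sequentially)
    have "\<forall>\<^sub>F m in sequentially. (\<integral>z. norm (s k (T m z) - s k (S z)) \<partial>\<Omega>) < e / 2"
      using s(2)[of k] \<open>e > 0\<close> unfolding P_def by (intro order_tendstoD) auto
    then obtain m0 where m0: "\<And>m. m \<ge> m0 \<Longrightarrow> (\<integral>z. norm (s k (T m z) - s k (S z)) \<partial>\<Omega>) < e / 2"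
      by (auto simp: eventually_sequentially)
    have sh: "integrable M (\<lambda>x. s k x - h x)" using s h by auto
    show "\<exists>m0. \<forall>m\<ge>m0. norm ((\<integral>z. norm (h (T m z) - h (S z)) \<partial>\<Omega>) - 0) < e"
    proof (intro exI[of _ m0] allI impI)
      fix m assume "m \<ge> m0"
      have i: "integrable \<Omega> (\<lambda>z. norm (s k (T m z) - h (T m z)))"
        "integrable \<Omega> (\<lambda>z. norm (s k (S z) - h (S z)))"
        using intT[OF sh] intS[OF sh] by auto
      have "(\<integral>z. norm (h (T m z) - h (S z)) \<partial>\<Omega>) \<le> (\<integral>z. norm (s k (T m z) - s k (S z)) +
        norm (s k (T m z) - h (T m z)) + norm (s k (S z) - h (S z)) \<partial>\<Omega>)"
      proof (intro integral_mono int h Bochner_Integration.integrable_add i s)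
        fix z
        have "h (T m z) - h (S z) = (s k (T m z) - s k (S z)) - (s k (T m z) - h (T m z))
          + (s k (S z) - h (S z))" by simp
        then show "norm (h (T m z) - h (S z)) \<le> norm (s k (T m z) - s k (S z)) +
          norm (s k (T m z) - h (T m z)) + norm (s k (S z) - h (S z))"
          by (metis norm_triangle_le norm_triangle_ineq4 add_right_mono)
      qed
      also have "\<dots> = (\<integral>z. norm (s k (T m z) - s k (S z)) \<partial>\<Omega>) + 2 * (\<integral>x. norm (s k x - h x) \<partial>M)"
        using i int[OF s(1)] normT[OF sh] normS[OF sh] by simp
      also have "\<dots> < e" using k m0[OF \<open>m \<ge> m0\<close>] by simp
      finally show "norm ((\<integral>z. norm (h (T m z) - h (S z)) \<partial>\<Omega>) - 0) < e"
        by simp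
    qed
  qed
  have ind: "integrable M (\<lambda>x. indicator A x *\<^sub>R c)" if "A \<in> sets M" for A :: "'b set" and c :: 'c
    using that by (intro integrable_scaleR_left integrable_real_indicator) (auto simp: less_top[symmetric])
  \<comment> \<open>Induction over the Dynkin system: on a generator the integrals eventually
    vanish, a complement leaves the norm of the difference unchanged, and a disjoint union is an L1
    limit of finite sums.\<close>
  have baseP: "P (\<lambda>x. indicator A x *\<^sub>R c)" if "A \<in> sets M" for A c
    using G(1,2) that[unfolded G(3)]
  proof (induction rule: sigma_sets_induct_disjoint)
    case (basic A)
    show ?case unfolding P_def
    proof (rule tendsto_eventually, rule eventually_mono[OF ev[OF basic]])
      fix m assume "\<forall>z\<in>space \<Omega>. (T m z \<in> A) = (S z \<in> A)"
      then have "(\<integral>z. norm (indicat_real A (T m z) *\<^sub>R c - indicat_real A (S z) *\<^sub>R c) \<partial>\<Omega>) = (\<integral>z. 0 \<partial>\<Omega>)"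
        by (intro Bochner_Integration.integral_cong) (auto simp: indicator_def)
      then show "(\<integral>z. norm (indicat_real A (T m z) *\<^sub>R c - indicat_real A (S z) *\<^sub>R c) \<partial>\<Omega>) = 0" by simp
    qed
  next
    case empty
    show ?case by (simp add: P_def)
  next
    case (compl A)
    have "norm (indicat_real (space M - A) (T m z) *\<^sub>R c - indicat_real (space M - A) (S z) *\<^sub>R c) =
       norm (indicat_real A (T m z) *\<^sub>R c - indicat_real A (S z) *\<^sub>R c)" if "z \<in> space \<Omega>" for m z
      using measurable_space[OF T(1) that, of m] measurable_space[OF S(1) that]
      by (auto simp: indicator_def)
    then show ?case using compl.IH unfolding P_def by (simp cong: Bochner_Integration.integral_cong)
  next
    case (union A)
    then have A: "A i \<in> sets M" for i using G(3) by auto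
    have fin: "P (\<lambda>x. \<Sum>i<k. indicator (A i) x *\<^sub>R c)" for k :: nat
    proof (induction k)
      case 0
      show ?case by (simp add: P_def)
    next
      case (Suc k)
      show ?case unfolding sum.lessThan_Suc
        by (intro addP Suc union ind A Bochner_Integration.integrable_sum)
    qed
    show ?case
    proof (rule limP[OF _ _ fin])
      show "integrable M (\<lambda>x. indicat_real (\<Union> (range A)) x *\<^sub>R c)" by (intro ind) (auto simp: A)
      show "integrable M (\<lambda>x. \<Sum>i<k. indicat_real (A i) x *\<^sub>R c)" for k
        by (intro ind A Bochner_Integration.integrable_sum)
      have "(\<lambda>k. \<integral>x. norm ((\<Sum>i<k. indicat_real (A i) x *\<^sub>R c) - indicat_real (\<Union> (range A)) x *\<^sub>R c) \<partial>M)
        \<longlonglongrightarrow> (\<integral>x. 0 \<partial>M)"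
      \<comment> \<open>By disjointness the partial sum is again an indicator times
        \<open>c\<close>, so each of the two terms is bounded by \<open>norm c\<close>.\<close>
      proof (rule integral_dominated_convergence[where w = "\<lambda>_. 2 * norm c"])
        have eq: "(\<Sum>i<k. indicat_real (A i) x *\<^sub>R c) = indicat_real (\<Union>i<k. A i) x *\<^sub>R c" for k x
          using union(1)
          by (simp add: indicator_UN_disjoint[of "{..<k}"] disjoint_family_on_mono[of "{..<k}" UNIV] flip: scaleR_left.sum)
        show "AE x in M. (\<lambda>k. norm ((\<Sum>i<k. indicat_real (A i) x *\<^sub>R c) - indicat_real (\<Union> (range A)) x *\<^sub>R c)) \<longlonglongrightarrow> 0"
          unfolding eq
          by (intro AE_I2 tendsto_norm_zero LIM_zero tendsto_scaleR tendsto_const LIMSEQ_indicator_UN)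
        show "AE x in M. norm (norm ((\<Sum>i<k. indicat_real (A i) x *\<^sub>R c) - indicat_real (\<Union> (range A)) x *\<^sub>R c)) \<le> 2 * norm c" for k
          unfolding eq by (auto simp: indicator_def)
        have "(\<lambda>x. \<Sum>i<k. indicat_real (A i) x *\<^sub>R c) \<in> borel_measurable M" for k
          using ind[OF A] by (intro borel_measurable_sum) auto
        moreover have U: "(\<lambda>x. indicat_real (\<Union> (range A)) x *\<^sub>R c) \<in> borel_measurable M"
          by (intro borel_measurable_integrable ind) (auto simp: A)
        ultimately show "(\<lambda>x. norm ((\<Sum>i<k. indicat_real (A i) x *\<^sub>R c) -
            indicat_real (\<Union> (range A)) x *\<^sub>R c)) \<in> borel_measurable M" for k
          by (rule measurable_compose[OF borel_measurable_diff borel_measurable_norm])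
      qed auto
      then show "(\<lambda>k. \<integral>x. norm ((\<Sum>i<k. indicat_real (A i) x *\<^sub>R c) - indicat_real (\<Union> (range A)) x *\<^sub>R c) \<partial>M)
        \<longlonglongrightarrow> 0" by simp
    qed
  qed
  have "P f"
    using f
  proof (induction rule: integrable_induct)
    case (base A c)
    then show ?case by (intro baseP)
  next
    case (add f g)
    then show ?case by (intro addP)
  next
    case (lim f s)
    have "(\<lambda>k. \<integral>x. norm (s k x - f x) \<partial>M) \<longlonglongrightarrow> (\<integral>x. 0 \<partial>M)"
    \<comment> \<open>The approximants supplied by the induction rule satisfy
      \<open>norm (s k x) \<le> 2 * norm (f x)\<close>; subtracting \<open>f x\<close> adds one more
      \<open>norm (f x)\<close>.\<close>
    proof (rule integral_dominated_convergence[where w = "\<lambda>x. 3 * norm (f x)"])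
      show "AE x in M. (\<lambda>k. norm (s k x - f x)) \<longlonglongrightarrow> 0"
        using lim.hyps(2) by (intro AE_I2 tendsto_norm_zero LIM_zero)
      show "AE x in M. norm (norm (s k x - f x)) \<le> 3 * norm (f x)" for k
      proof (rule AE_I2)
        fix x assume "x \<in> space M"
        then show "norm (norm (s k x - f x)) \<le> 3 * norm (f x)"
          using lim.hyps(3)[of x k] norm_triangle_ineq4[of "s k x" "f x"] by simp
      qed
    qed (use lim.hyps(1,4) in auto)
    then show ?case by (intro limP[OF lim.hyps(4,1) lim.IH]) simp
  qed
  then show ?thesis by (simp add: P_def)
qed

section \<open>Unitary matrices\<close>

lemma mat_adjoint_mult:
  fixes A B :: "complex mat"
  assumes "A \<in> carrier_mat n m" "B \<in> carrier_mat m k"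
  shows "mat_adjoint (A * B) = mat_adjoint B * mat_adjoint A"
  using assms
  by (intro eq_matI) (auto simp: index_adjoint scalar_prod_def mult.commute)

lemma mat_adjoint_smult: "mat_adjoint (c \<cdot>\<^sub>m A) = conjugate c \<cdot>\<^sub>m mat_adjoint (A :: complex mat)"
  by (intro eq_matI) (auto simp: index_adjoint)

lemma smult_smult_mat_mult: "a \<cdot>\<^sub>m (b \<cdot>\<^sub>m A) = (a * b) \<cdot>\<^sub>m (A :: 'a :: semigroup_mult mat)"
  by (intro eq_matI) (auto simp: mult.assoc)

lemma one_smult_mat [simp]: "1 \<cdot>\<^sub>m A = (A :: 'a :: monoid_mult mat)"
  by (intro eq_matI) auto

lemma mat_adjoint_adjoint [simp]: "mat_adjoint (mat_adjoint A) = A"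
  by (intro eq_matI) (auto simp: index_adjoint)

lemma carrier_mat_adjoint [simp, intro]:
  "A \<in> carrier_mat n m \<Longrightarrow> mat_adjoint A \<in> carrier_mat m n"
  by (auto intro!: carrier_matI)

lemma square_mat_mult [simp]:
  fixes A B :: "'a :: semiring_1 mat"
  assumes "A \<in> carrier_mat n n"
  shows "B \<in> carrier_mat n n \<Longrightarrow> A * B \<in> carrier_mat n n" "1\<^sub>m n * A = A" "A * 1\<^sub>m n = A"
  using assms by auto

definition unitary_mat :: "nat \<Rightarrow> complex mat \<Rightarrow> bool" where
  "unitary_mat n U \<longleftrightarrow> U \<in> carrier_mat n n \<and> U * mat_adjoint U = 1\<^sub>m n \<and> mat_adjoint U * U = 1\<^sub>m n"

lemma unitary_matI:
  assumes "U \<in> carrier_mat n n" "U * mat_adjoint U = 1\<^sub>m n"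
  shows "unitary_mat n U"
  unfolding unitary_mat_def
  using assms mat_mult_left_right_inverse[of U n "mat_adjoint U"] by auto

lemma unitary_mat_adjoint: "unitary_mat n U \<Longrightarrow> unitary_mat n (mat_adjoint U)"
  by (auto simp: unitary_mat_def)

lemma unitary_mat_smult:
  assumes "unitary_mat n U" "cmod c = 1"
  shows "unitary_mat n (c \<cdot>\<^sub>m U)"
proof -
  have c: "c * cnj c = 1" "cnj c * c = 1"
    using assms(2) complex_norm_square[of c] by (simp_all add: mult.commute)
  show ?thesis
    using assms(1) unfolding unitary_mat_def mat_adjoint_smult
    by (simp add: mult_smult_assoc_mat[of _ n n _ n] mult_smult_distrib[of _ n n _ n]
       smult_smult_mat_mult c)
qed

lemma unitary_mat_mult:
  assumes "unitary_mat n U" "unitary_mat n U'"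
  shows "unitary_mat n (U * U')"
proof (rule unitary_matI)
  have c: "U \<in> carrier_mat n n" "U' \<in> carrier_mat n n"
    "mat_adjoint U \<in> carrier_mat n n" "mat_adjoint U' \<in> carrier_mat n n"
    and e: "U * mat_adjoint U = 1\<^sub>m n" "U' * mat_adjoint U' = 1\<^sub>m n"
    using assms by (auto simp: unitary_mat_def)
  show "U * U' \<in> carrier_mat n n" using c by simp
  have "U * U' * mat_adjoint (U * U') = U * (U' * mat_adjoint U') * mat_adjoint U"
    using c by (simp add: mat_adjoint_mult[OF c(1,2)] assoc_mult_mat[of _ n n _ n _ n])
  then show "U * U' * mat_adjoint (U * U') = 1\<^sub>m n"
    using c e by simp
qed

lemma det_unitary_mat_nonzero: "unitary_mat n U \<Longrightarrow> det U \<noteq> 0"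
  using det_mult[of U n "mat_adjoint U"] by (auto simp: unitary_mat_def)

text \<open>The entrywise \<open>\<ell>\<^sup>1\<close>-norm serves because \<open>u\<close> and \<open>v\<close> are monomial: multiplying by them preserves it.\<close>

definition entry_sum :: "nat \<Rightarrow> complex mat \<Rightarrow> real" where
  "entry_sum n A = (\<Sum>i<n. \<Sum>j<n. cmod (A $$ (i, j)))"

text \<open>Column sums control multiplication from the left; row sums, after passing to adjoints,
  control multiplication from the right. Matrices with at most one nonzero entry per row and column,
  each of modulus at most 1, qualify.\<close>

definition doubly_substochastic :: "nat \<Rightarrow> complex mat \<Rightarrow> bool" where
  "doubly_substochastic n A \<longleftrightarrow> (\<forall>i<n. (\<Sum>j<n. cmod (A $$ (i, j))) \<le> 1) \<and>
     (\<forall>j<n. (\<Sum>i<n. cmod (A $$ (i, j))) \<le> 1)"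

lemma doubly_substochastic_adjoint:
  assumes "A \<in> carrier_mat n n" "doubly_substochastic n A"
  shows "doubly_substochastic n (mat_adjoint A)"
  using assms by (auto simp: doubly_substochastic_def index_adjoint)

lemma doubly_substochastic_smult:
  assumes "A \<in> carrier_mat n n" "doubly_substochastic n A" "cmod c = 1"
  shows "doubly_substochastic n (c \<cdot>\<^sub>m A)"
  using assms by (auto simp: doubly_substochastic_def norm_mult)

text \<open>After the triangle inequality and an exchange of sums, row \<open>k\<close> of
  \<open>B\<close> is weighted by the absolute sum of column \<open>k\<close> of \<open>A\<close>,
  which is at most 1.\<close>

lemma entry_sum_mult_left:
  assumes "A \<in> carrier_mat n n" "B \<in> carrier_mat n n" "doubly_substochastic n A"
  shows "entry_sum n (A * B) \<le> entry_sum n B"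
proof -
  have "entry_sum n (A * B) \<le> (\<Sum>i<n. \<Sum>j<n. \<Sum>k<n. cmod (A $$ (i, k)) * cmod (B $$ (k, j)))"
    unfolding entry_sum_def
  proof (intro sum_mono)
    fix i j assume "i \<in> {..<n}" "j \<in> {..<n}"
    then have "(A * B) $$ (i, j) = (\<Sum>k<n. A $$ (i, k) * B $$ (k, j))"
      using assms by (auto simp: scalar_prod_def atLeast0LessThan)
    then show "cmod ((A * B) $$ (i, j)) \<le> (\<Sum>k<n. cmod (A $$ (i, k)) * cmod (B $$ (k, j)))"
      by (auto simp: norm_mult[symmetric] intro!: norm_sum)
  qed
  also have "\<dots> = (\<Sum>i<n. \<Sum>k<n. \<Sum>j<n. cmod (A $$ (i, k)) * cmod (B $$ (k, j)))"
    by (intro sum.cong refl sum.swap)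
  also have "\<dots> = (\<Sum>k<n. \<Sum>i<n. \<Sum>j<n. cmod (A $$ (i, k)) * cmod (B $$ (k, j)))"
    by (rule sum.swap)
  also have "\<dots> = (\<Sum>k<n. (\<Sum>i<n. cmod (A $$ (i, k))) * (\<Sum>j<n. cmod (B $$ (k, j))))"
    by (simp add: sum_product)
  also have "\<dots> \<le> (\<Sum>k<n. 1 * (\<Sum>j<n. cmod (B $$ (k, j))))"
    using assms(3) by (intro sum_mono mult_right_mono) (auto simp: doubly_substochastic_def sum_nonneg)
  finally show ?thesis by (simp add: entry_sum_def)
qed

lemma entry_sum_adjoint:
  assumes "A \<in> carrier_mat n n"
  shows "entry_sum n (mat_adjoint A) = entry_sum n A"
proof -
  have "entry_sum n (mat_adjoint A) = (\<Sum>i<n. \<Sum>j<n. cmod (A $$ (j, i)))"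
    using assms by (auto simp: entry_sum_def index_adjoint intro!: sum.cong)
  also have "\<dots> = entry_sum n A" unfolding entry_sum_def by (rule sum.swap)
  finally show ?thesis .
qed

lemma entry_sum_mult_right:
  assumes "A \<in> carrier_mat n n" "B \<in> carrier_mat n n" "doubly_substochastic n B"
  shows "entry_sum n (A * B) \<le> entry_sum n A"
  using entry_sum_mult_left[of "mat_adjoint B" n "mat_adjoint A"] assms
    doubly_substochastic_adjoint[of B n] entry_sum_adjoint[of "A * B" n] entry_sum_adjoint[of A n]
    mat_adjoint_mult[of A n n B n] by simp

lemma entry_sum_diff_eq_0_iff:
  assumes "A \<in> carrier_mat n n" "B \<in> carrier_mat n n"
  shows "entry_sum n (A - B) = 0 \<longleftrightarrow> A = B"
proof
  assume "entry_sum n (A - B) = 0"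
  then have "\<forall>i<n. \<forall>j<n. cmod ((A - B) $$ (i, j)) = 0"
    unfolding entry_sum_def by (simp add: sum_nonneg_eq_0_iff sum_nonneg)
  then show "A = B" using assms by (intro eq_matI) auto
qed (use assms in \<open>simp add: entry_sum_def\<close>)

text \<open>The differences satisfy \<open>A' - B' = mat_adjoint U * (A - B) * U'\<close>, and this
  can be solved for \<open>A - B\<close>. No multiplication involved increases the entry sum, so the
  two inequalities give equality. Taking for \<open>A\<close>, \<open>B\<close> two values of
  \<open>\<zeta>\<close> and for \<open>A'\<close>, \<open>B'\<close> the values at the unshifted
  points shows that their distance is preserved.\<close>

lemma entry_sum_intertwine:
  assumes U: "unitary_mat n U" "doubly_substochastic n U"
    and U': "unitary_mat n U'" "doubly_substochastic n U'"
    and c: "A \<in> carrier_mat n n" "A' \<in> carrier_mat n n" "B \<in> carrier_mat n n" "B' \<in> carrier_mat n n"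
    and eq: "U * A' = A * U'" "U * B' = B * U'"
  shows "entry_sum n (A' - B') = entry_sum n (A - B)"
proof -
  have cU: "U \<in> carrier_mat n n" "mat_adjoint U \<in> carrier_mat n n"
    "U' \<in> carrier_mat n n" "mat_adjoint U' \<in> carrier_mat n n"
    and e: "mat_adjoint U * U = 1\<^sub>m n" "U' * mat_adjoint U' = 1\<^sub>m n"
    using U U' by (auto simp: unitary_mat_def)
  have cd: "A - B \<in> carrier_mat n n" "A' - B' \<in> carrier_mat n n" using c by auto
  have d: "U * (A' - B') = (A - B) * U'"
    using mult_minus_distrib_mat[OF cU(1) c(2,4)] minus_mult_distrib_mat[OF c(1,3) cU(3)] eq by simp
  have "A' - B' = mat_adjoint U * (U * (A' - B'))"
    using cU cd e by (simp add: assoc_mult_mat[of _ n n _ n _ n, symmetric])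
  then have "A' - B' = mat_adjoint U * ((A - B) * U')" by (simp add: d)
  then have 1: "entry_sum n (A' - B') \<le> entry_sum n (A - B)"
    using entry_sum_mult_left[of "mat_adjoint U" n "(A - B) * U'"] entry_sum_mult_right[of "A - B" n U']
      U U' cU cd doubly_substochastic_adjoint[OF cU(1) U(2)] by simp
  have "A - B = (A - B) * U' * mat_adjoint U'"
    using cU cd e by (simp add: assoc_mult_mat[of _ n n _ n _ n])
  then have "A - B = U * (A' - B') * mat_adjoint U'" by (simp add: d)
  then have 2: "entry_sum n (A - B) \<le> entry_sum n (A' - B')"
    using entry_sum_mult_right[of "U * (A' - B')" n "mat_adjoint U'"] entry_sum_mult_left[of U n "A' - B'"]
      U U' cU cd doubly_substochastic_adjoint[OF cU(3) U'(2)] by simp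
  from 1 2 show ?thesis by simp
qed

section \<open>The unitaries u and v and their commutation relations\<close>

lemma norm_omega [simp]: "cmod (\<omega> n) = 1"
proof -
  have "\<omega> n = exp (\<i> * of_real (2 * pi / real n))"
    by (simp add: \<omega>_def field_simps)
  then show ?thesis by (simp only: norm_exp_i_times)
qed

lemma carrier_u_mat [simp]: "u_mat n \<in> carrier_mat n n"
  and carrier_v_mat [simp]: "v_mat n \<in> carrier_mat n n"
  by (auto simp: u_mat_def v_mat_def)

lemma unitary_u_mat: "unitary_mat n (u_mat n)"
proof (rule unitary_matI)
  have c: "z * cnj z = 1" if "cmod z = 1" for z
    using that complex_norm_square[of z] by simp
  show "u_mat n * mat_adjoint (u_mat n) = 1\<^sub>m n"
  proof (rule eq_matI)
    fix i j assume "i < dim_row (1\<^sub>m n :: complex mat)" "j < dim_col (1\<^sub>m n :: complex mat)"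
    then have ij: "i < n" "j < n" by auto
    have "(u_mat n * mat_adjoint (u_mat n)) $$ (i, j) = (\<Sum>k<n. u_mat n $$ (i, k) * cnj (u_mat n $$ (j, k)))"
      using ij by (simp add: u_mat_def scalar_prod_def index_adjoint atLeast0LessThan)
    also have "\<dots> = (\<Sum>k<n. if k = i then \<omega> n ^ i * cnj (if j = i then \<omega> n ^ j else 0) else 0)"
      using ij by (intro sum.cong) (auto simp: u_mat_def)
    also have "\<dots> = 1\<^sub>m n $$ (i, j)" using ij c[of "\<omega> n ^ i"] by (auto simp: norm_power)
    finally show "(u_mat n * mat_adjoint (u_mat n)) $$ (i, j) = 1\<^sub>m n $$ (i, j)" .
  qed (auto simp: u_mat_def)
qed simp

lemma unitary_v_mat: "unitary_mat n (v_mat n)"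
  by (rule unitary_matI) (simp_all add: v_unitary)

lemma doubly_substochastic_u_mat: "doubly_substochastic n (u_mat n)"
proof -
  have "(\<Sum>j<n. cmod (u_mat n $$ (i, j))) = (\<Sum>j<n. if j = i then 1 else 0)"
    "(\<Sum>j<n. cmod (u_mat n $$ (j, i))) = (\<Sum>j<n. if j = i then 1 else 0)" if "i < n" for i
    using that by (auto simp: u_mat_def norm_power simp del: sum.delta sum.delta' intro!: sum.cong)
  then show ?thesis by (auto simp: doubly_substochastic_def)
qed

lemma doubly_substochastic_v_mat: "doubly_substochastic n (v_mat n)"
proof -
  have "(\<Sum>j<n. cmod (v_mat n $$ (i, j))) \<le> 1" if "i < n" for i
  proof -
    have "(\<Sum>j<n. cmod (v_mat n $$ (i, j))) = (\<Sum>j<n. if j = Suc i mod n then 1 else 0)"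
      using that by (auto simp: v_mat_def simp del: sum.delta sum.delta' intro!: sum.cong)
    then show ?thesis by simp
  qed
  moreover have "(\<Sum>i<n. cmod (v_mat n $$ (i, j))) \<le> 1" if "j < n" for j
  proof -
    let ?S = "{i\<in>{..<n}. j = Suc i mod n}"
    have "(\<Sum>i<n. cmod (v_mat n $$ (i, j))) = (\<Sum>i<n. if j = Suc i mod n then 1 else 0)"
      using that by (auto simp: v_mat_def simp del: sum.delta sum.delta' intro!: sum.cong)
    also have "\<dots> = real (card ?S)" by (simp add: sum.If_cases Int_def)
    \<comment> \<open>The successor modulo \<open>n\<close> is injective below \<open>n\<close>, so
      at most one row has its nonzero entry in column \<open>j\<close>.\<close>
    also have "card ?S \<le> Suc 0"
      by (subst card_le_Suc0_iff_eq) (auto dest: Suc_mod_inj)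
    finally show ?thesis by simp
  qed
  ultimately show ?thesis by (auto simp: doubly_substochastic_def)
qed

text \<open>Both relations come from \<open>v_u_commute\<close>, multiplied on both sides by the
  adjoint of \<open>v\<close>, respectively of \<open>u\<close>. They are needed in this form
  because \<open>W\<close> is built from the adjoints.\<close>

lemma adjoint_v_mult_u:
  "mat_adjoint (v_mat n) * u_mat n = conjugate (\<omega> n) \<cdot>\<^sub>m (u_mat n * mat_adjoint (v_mat n))"
  and adjoint_u_mult_v:
  "mat_adjoint (u_mat n) * v_mat n = \<omega> n \<cdot>\<^sub>m (v_mat n * mat_adjoint (u_mat n))"
proof -
  let ?u = "u_mat n" and ?v = "v_mat n"
  have c: "conjugate (\<omega> n) * \<omega> n = 1"
    using complex_norm_square[of "\<omega> n"] by (simp add: mult.commute)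
  have e: "?u * mat_adjoint ?u = 1\<^sub>m n" "mat_adjoint ?u * ?u = 1\<^sub>m n"
     "?v * mat_adjoint ?v = 1\<^sub>m n" "mat_adjoint ?v * ?v = 1\<^sub>m n"
    using unitary_u_mat unitary_v_mat by (auto simp: unitary_mat_def)
  note [simp] = assoc_mult_mat[of _ n n _ n _ n]
    mult_smult_assoc_mat[of _ n n _ n] mult_smult_distrib[of _ n n _ n]
  have 1: "mat_adjoint ?v * (?v * ?u) * mat_adjoint ?v = ?u * mat_adjoint ?v"
    using e by (simp add: assoc_mult_mat[of _ n n _ n _ n, symmetric] del: assoc_mult_mat)
  have 2: "mat_adjoint ?v * (?u * ?v) * mat_adjoint ?v = mat_adjoint ?v * ?u"
    using e by simp
  show "mat_adjoint ?v * ?u = conjugate (\<omega> n) \<cdot>\<^sub>m (?u * mat_adjoint ?v)"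
    unfolding 1[symmetric] unfolding v_u_commute using 2 c by (simp add: smult_smult_mat_mult)
  have 3: "mat_adjoint ?u * (?v * ?u) * mat_adjoint ?u = mat_adjoint ?u * ?v"
    using e by simp
  have 4: "mat_adjoint ?u * (?u * ?v) * mat_adjoint ?u = ?v * mat_adjoint ?u"
    using e by (simp add: assoc_mult_mat[of _ n n _ n _ n, symmetric] del: assoc_mult_mat)
  show "mat_adjoint ?u * ?v = \<omega> n \<cdot>\<^sub>m (?v * mat_adjoint ?u)"
    unfolding 3[symmetric] 4[symmetric] unfolding v_u_commute by simp
qed

section \<open>Intertwiners over the Bernoulli shift\<close>

text \<open>The inverse of \<open>shift\<close> in closed form, written \<tau> in the overview;
  \<open>V_op\<close> is composition with it.\<close>

definition unshift :: "(int \<Rightarrow> 'l) \<Rightarrow> int \<Rightarrow> 'l" where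
  "unshift x = (\<lambda>i. x (i + 1))"

lemma prob_space_bernoulli:
  assumes "prob_space N"
  shows "prob_space (bernoulli N)"
  unfolding bernoulli_def by (intro prob_space_PiM assms)

lemma space_bernoulli: "space (bernoulli N) = seq_space (space N)"
  by (simp add: bernoulli_def seq_space_def space_PiM)

lemma measurable_unshift: "unshift \<in> bernoulli N \<rightarrow>\<^sub>M bernoulli N"
  unfolding bernoulli_def unshift_def
  by (rule measurable_PiM_single') (auto simp: space_PiM PiE_iff)

lemma distr_unshift:
  assumes "prob_space N"
  shows "distr (bernoulli N) (bernoulli N) unshift = bernoulli N"
  using distr_PiM_reindex[of UNIV "\<lambda>_. N" "\<lambda>i::int. i + 1" UNIV] assms
  by (simp add: bernoulli_def unshift_def[abs_def] restrict_def)

lemma AE_measure_preserving: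
  assumes "f \<in> A \<rightarrow>\<^sub>M B" "distr A B f = B" "AE x in B. P x"
  shows "AE x in A. P (f x)"
  using AE_distrD[OF assms(1), of P] assms(2,3) by metis

text \<open>Double substochasticity of \<open>A\<close> and \<open>B\<close> keeps the entrywise
  distance of two values of \<open>\<zeta>\<close> unchanged along the shift, as long as both points
  have the same coordinate 0. The nested almost everywhere statement expresses constancy without
  naming the constant.\<close>

lemma intertwiner_AE_const:
  fixes N :: "'l measure" and \<zeta> :: "(int \<Rightarrow> 'l) \<Rightarrow> complex mat" and A B :: "'l \<Rightarrow> complex mat"
  assumes N: "prob_space N"
    and A: "\<And>a. a \<in> space N \<Longrightarrow> unitary_mat n (A a)" "\<And>a. a \<in> space N \<Longrightarrow> doubly_substochastic n (A a)"
    and B: "\<And>a. a \<in> space N \<Longrightarrow> unitary_mat n (B a)" "\<And>a. a \<in> space N \<Longrightarrow> doubly_substochastic n (B a)"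
    and \<zeta>: "\<zeta> \<in> Linf_mat (bernoulli N) n"
    and eq: "AE x in bernoulli N. A (x 0) * \<zeta> (unshift x) = \<zeta> x * B (x 0)"
  shows "AE x in bernoulli N. AE y in bernoulli N. \<zeta> x = \<zeta> y"
proof -
  define M where "M = bernoulli N"
  \<comment> \<open>\<open>T K (x, y)\<close> keeps the coordinates of \<open>x\<close> in \<open>K\<close> and resamples the others from \<open>y\<close>; \<open>\<zeta>\<close> depends
    on the coordinates in \<open>K\<close> only iff \<open>d K = 0\<close> almost everywhere.\<close>
  define T where "T K z = override_on (snd z) (fst z) K" for K and z :: "(int \<Rightarrow> 'l) \<times> (int \<Rightarrow> 'l)"
  define d where "d K z = entry_sum n (\<zeta> (T K z) - \<zeta> (fst z))" for K z
  let ?M2 = "M \<Otimes>\<^sub>M M"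
  let ?s2 = "\<lambda>(x, y). (unshift x, unshift y)"
  interpret M: prob_space M unfolding M_def using N by (rule prob_space_bernoulli)
  interpret MM: pair_prob_space M M ..
  have T: "T K \<in> ?M2 \<rightarrow>\<^sub>M M" "distr ?M2 M (T K) = M" for K
    using distr_override_on[OF N, of K] unfolding T_def[abs_def] M_def bernoulli_def by auto
  have fst: "fst \<in> ?M2 \<rightarrow>\<^sub>M M" "distr ?M2 M fst = M"
    by (auto simp: M.distr_pair_fst M.emeasure_space_1)
  have sh: "unshift \<in> M \<rightarrow>\<^sub>M M" "distr M M unshift = M"
    using measurable_unshift distr_unshift[OF N] by (auto simp: M_def)
  have sh2: "?s2 \<in> ?M2 \<rightarrow>\<^sub>M ?M2" "distr ?M2 ?M2 ?s2 = ?M2"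
    using sh pair_measure_distr[OF sh(1) sh(1)] M.sigma_finite_measure_axioms by auto
  have car: "\<zeta> x \<in> carrier_mat n n" if "x \<in> space M" for x
    using \<zeta> that by (auto simp: Linf_mat_def M_def)
  have int: "integrable M (\<lambda>x. \<zeta> x $$ (i, j))" if ij: "i < n" "j < n" for i j
  proof -
    obtain b where "AE x in M. \<forall>i<n. \<forall>j<n. cmod (\<zeta> x $$ (i, j)) \<le> b"
      using \<zeta> unfolding Linf_mat_def M_def by blast
    then have "AE x in M. cmod (\<zeta> x $$ (i, j)) \<le> b" using ij by auto
    then show ?thesis
      using \<zeta> ij by (intro M.integrable_const_bound) (auto simp: Linf_mat_def M_def)
  qed
  \<comment> \<open>Values of \<open>\<zeta>\<close> are known to be n by n matrices only on the
    space, so the expansion is restricted to it. Measurability and integrability of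
    \<open>d K\<close> are then obtained entry by entry.\<close>
  have d_sum: "d K z = (\<Sum>i<n. \<Sum>j<n. cmod (\<zeta> (T K z) $$ (i, j) - \<zeta> (fst z) $$ (i, j)))"
    if "z \<in> space ?M2" for K z
    using car[OF measurable_space[OF T(1) that]] car[OF measurable_space[OF fst(1) that]]
    by (simp add: d_def entry_sum_def)
  have int_entry: "integrable ?M2 (\<lambda>z. cmod (\<zeta> (T K z) $$ (i, j) - \<zeta> (fst z) $$ (i, j)))"
    if ij: "i < n" "j < n" for K i j
    using integrable_distr[OF T(1), unfolded T(2), OF int[OF ij]]
      integrable_distr[OF fst(1), unfolded fst(2), OF int[OF ij]]
    by (intro integrable_norm Bochner_Integration.integrable_diff)
  have d_int: "integrable ?M2 (d K)" for K
  proof -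
    have "integrable ?M2 (\<lambda>z. \<Sum>i<n. \<Sum>j<n. cmod (\<zeta> (T K z) $$ (i, j) - \<zeta> (fst z) $$ (i, j)))"
      by (intro Bochner_Integration.integrable_sum int_entry) auto
    then show ?thesis
      by (rule iffD1[OF Bochner_Integration.integrable_cong, rotated 2]) (simp_all add: d_sum)
  qed
  have d_nonneg: "0 \<le> d K z" for K z by (simp add: d_def entry_sum_def sum_nonneg)
  \<comment> \<open>As 0 lies in \<open>K\<close>, the points \<open>T K z\<close> and
    \<open>fst z\<close> share coordinate 0 and are intertwined by the same two unitaries, so
    \<open>entry_sum_intertwine\<close> applies. Unshifting both points turns \<open>K\<close> into
    its translate by -1 and \<open>z\<close> into the unshifted pair, and the unshift of pairs
    preserves the measure.\<close>
  have step: "(\<integral>z. d K z \<partial>?M2) = (\<integral>z. d {i. i + 1 \<in> K} z \<partial>?M2)" if K: "0 \<in> K" for K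
  proof -
    have e: "AE x in M. A (x 0) * \<zeta> (unshift x) = \<zeta> x * B (x 0)" using eq unfolding M_def .
    have "AE z in ?M2. d K z = d {i. i + 1 \<in> K} (?s2 z)"
      using AE_measure_preserving[OF T e, of K] AE_measure_preserving[OF fst e]
    proof (rule AE_mp[OF AE_conjI], intro AE_I2 impI)
      fix z assume z: "z \<in> space ?M2" and
        h: "A (T K z 0) * \<zeta> (unshift (T K z)) = \<zeta> (T K z) * B (T K z 0) \<and>
          A (fst z 0) * \<zeta> (unshift (fst z)) = \<zeta> (fst z) * B (fst z 0)"
      have 0: "T K z 0 = fst z 0" using K by (simp add: T_def)
      have u: "unshift (T K z) = T {i. i + 1 \<in> K} (?s2 z)" "unshift (fst z) = fst (?s2 z)"
        by (auto simp: T_def unshift_def override_on_def split: prod.split)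
      have sp: "T K z \<in> space M" "fst z \<in> space M"
        using measurable_space[OF T(1) z] measurable_space[OF fst(1) z] by auto
      then have a: "fst z 0 \<in> space N" by (auto simp: M_def space_bernoulli seq_space_def)
      show "d K z = d {i. i + 1 \<in> K} (?s2 z)"
        unfolding d_def u[symmetric]
        by (rule entry_sum_intertwine[symmetric, OF A[OF a] B[OF a]])
          (use h sp measurable_space[OF sh(1)] in \<open>auto simp: 0 intro!: car\<close>)
    qed
    then have "(\<integral>z. d K z \<partial>?M2) = (\<integral>z. d {i. i + 1 \<in> K} (?s2 z) \<partial>?M2)"
      using d_int measurable_compose[OF sh2(1) borel_measurable_integrable[OF d_int]]
      by (intro integral_cong_AE) auto
    also have "\<dots> = (\<integral>z. d {i. i + 1 \<in> K} z \<partial>distr ?M2 ?M2 ?s2)"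
      using d_int by (intro integral_distr[symmetric] sh2) auto
    finally show ?thesis using sh2 by simp
  qed
  \<comment> \<open>A generating cylinder constrains finitely many coordinates, all eventually in
    \<open>K m\<close>; from then on \<open>T (K m) z\<close> lies in it exactly when
    \<open>fst z\<close> does. Thus \<open>tendsto_L1_comp\<close> applies to each entry of
    \<open>\<zeta>\<close>.\<close>
  have lim: "(\<lambda>m. \<integral>z. d (K m) z \<partial>?M2) \<longlonglongrightarrow> 0" if K: "\<And>i. \<forall>\<^sub>F m in sequentially. i \<in> K m" for K
  proof -
    have "(\<lambda>m. \<integral>z. cmod (\<zeta> (T (K m) z) $$ (i, j) - \<zeta> (fst z) $$ (i, j)) \<partial>?M2) \<longlonglongrightarrow> 0"
      if ij: "i < n" "j < n" for i j
    proof (rule tendsto_L1_comp[OF T fst _ Int_stable_prod_algebra, where f = "\<lambda>x. \<zeta> x $$ (i, j)"])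
      show "prob_space ?M2" by (intro prob_space_pair M.prob_space_axioms)
      show "prod_algebra UNIV (\<lambda>_. N) \<subseteq> Pow (space M)"
        using prod_algebra_sets_into_space[of UNIV "\<lambda>_. N"] by (simp add: M_def bernoulli_def space_PiM)
      show "sets M = sigma_sets (space M) (prod_algebra UNIV (\<lambda>_. N))"
        by (simp add: M_def bernoulli_def sets_PiM space_PiM)
      fix C :: "(int \<Rightarrow> 'l) set"
      assume "C \<in> prod_algebra UNIV (\<lambda>_. N)"
      then obtain J E where C: "C = prod_emb UNIV (\<lambda>_. N) J (Pi\<^sub>E J E)" "finite J"
        by (auto elim!: prod_algebraE)
      then have "\<forall>\<^sub>F m in sequentially. \<forall>i\<in>J. i \<in> K m"
        using K by (simp add: eventually_ball_finite)
      then show "\<forall>\<^sub>F m in sequentially. \<forall>z\<in>space ?M2. T (K m) z \<in> C \<longleftrightarrow> fst z \<in> C"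
      proof eventually_elim
        case (elim m)
        show ?case
        proof
          fix z assume z: "z \<in> space ?M2"
          have "restrict (T (K m) z) J = restrict (fst z) J"
            using elim by (auto simp: T_def restrict_def)
          then show "T (K m) z \<in> C \<longleftrightarrow> fst z \<in> C"
            using measurable_space[OF T(1) z, of "K m"] measurable_space[OF fst(1) z]
            by (simp add: C prod_emb_def M_def bernoulli_def space_PiM)
        qed
      qed
    qed (rule int[OF ij])
    then have "(\<lambda>m. \<Sum>i<n. \<Sum>j<n. \<integral>z. cmod (\<zeta> (T (K m) z) $$ (i, j) - \<zeta> (fst z) $$ (i, j)) \<partial>?M2) \<longlonglongrightarrow> 0"
      by (intro tendsto_null_sum) auto
    moreover have "(\<Sum>i<n. \<Sum>j<n. \<integral>z. cmod (\<zeta> (T L z) $$ (i, j) - \<zeta> (fst z) $$ (i, j)) \<partial>?M2) =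
      (\<integral>z. d L z \<partial>?M2)" for L
    proof -
      have "(\<integral>z. d L z \<partial>?M2) =
        (\<integral>z. (\<Sum>i<n. \<Sum>j<n. cmod (\<zeta> (T L z) $$ (i, j) - \<zeta> (fst z) $$ (i, j))) \<partial>?M2)"
        by (intro Bochner_Integration.integral_cong refl d_sum)
      also have "\<dots> = (\<Sum>i<n. \<Sum>j<n. \<integral>z. cmod (\<zeta> (T L z) $$ (i, j) - \<zeta> (fst z) $$ (i, j)) \<partial>?M2)"
        by (subst Bochner_Integration.integral_sum)
           (auto intro!: sum.cong Bochner_Integration.integral_sum Bochner_Integration.integrable_sum int_entry)
      finally show ?thesis ..
    qed
    ultimately show ?thesis by simp
  qed
  have zero: "AE z in ?M2. \<zeta> (T K z) = \<zeta> (fst z)" if "(\<integral>z. d K z \<partial>?M2) = 0" for K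
  proof -
    have "AE z in ?M2. d K z = 0"
      using that d_int d_nonneg by (subst (asm) integral_nonneg_eq_0_iff_AE) auto
    then show ?thesis
    proof (rule AE_mp, intro AE_I2 impI)
      fix z assume "z \<in> space ?M2" "d K z = 0"
      then show "\<zeta> (T K z) = \<zeta> (fst z)"
        using car measurable_space[OF T(1)] measurable_space[OF fst(1)]
        by (simp add: d_def entry_sum_diff_eq_0_iff)
    qed
  qed
  \<comment> \<open>Each \<open>{- int m..}\<close> contains 0, so \<open>step\<close> may be
    iterated; the sets exhaust the integers while the integral stays the same, so the limit 0 is the
    value at \<open>{0..}\<close>.\<close>
  have fwd: "(\<integral>z. d {0..} z \<partial>?M2) = (\<integral>z. d {- int m..} z \<partial>?M2)" for m
  proof (induction m)
    case (Suc m)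
    have "{i. i + 1 \<in> {- int m..}} = {- int (Suc m)..}" by auto
    then show ?case using Suc step[of "{- int m..}"] by simp
  qed simp
  \<comment> \<open>The set \<open>{..<0}\<close> omits 0, so \<open>step\<close> is read from right
    to left: it applies to \<open>{..<int (Suc m)}\<close>, which contains 0, and yields
    \<open>{..<int m}\<close>.\<close>
  have bwd: "(\<integral>z. d {..<0} z \<partial>?M2) = (\<integral>z. d {..<int m} z \<partial>?M2)" for m
  proof (induction m)
    case (Suc m)
    have "{i. i + 1 \<in> {..<int (Suc m)}} = {..<int m}" by auto
    then show ?case using Suc step[of "{..<int (Suc m)}"] by simp
  qed simp
  have "\<forall>\<^sub>F m in sequentially. i \<in> {- int m..}" for i
    using eventually_ge_at_top[of "nat (- i)"] by eventually_elim auto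
  then have "(\<integral>z. d {0..} z \<partial>?M2) = 0"
    using lim[of "\<lambda>m. {- int m..}"] by (simp flip: fwd add: LIMSEQ_const_iff)
  then have 1: "AE z in ?M2. \<zeta> (T {0..} z) = \<zeta> (fst z)" by (rule zero)
  have "\<forall>\<^sub>F m in sequentially. i \<in> {..<int m}" for i
    using eventually_ge_at_top[of "nat (i + 1)"] by eventually_elim auto
  then have "(\<integral>z. d {..<0} z \<partial>?M2) = 0"
    using lim[of "\<lambda>m. {..<int m}"] by (simp flip: bwd add: LIMSEQ_const_iff)
  then have 2: "AE z in ?M2. \<zeta> (T {..<0} z) = \<zeta> (fst z)" by (rule zero)
  have sw: "(\<lambda>(x, y). (y, x)) \<in> ?M2 \<rightarrow>\<^sub>M ?M2" "distr ?M2 ?M2 (\<lambda>(x, y). (y, x)) = ?M2"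
    using MM.distr_pair_swap by auto
  \<comment> \<open>Taking the nonnegative coordinates from x and the rest from y is the same as
    taking the negative ones from y and the rest from x. This common point has the value of
    \<open>\<zeta>\<close> at x by the first fact and at y by the second fact after
    swapping.\<close>
  have "AE z in ?M2. \<zeta> (fst z) = \<zeta> (snd z)"
    using 1 AE_measure_preserving[OF sw 2]
  proof eventually_elim
    case (elim z)
    have "T {..<0} (case z of (x, y) \<Rightarrow> (y, x)) = T {0..} z"
      by (auto simp: T_def override_on_def split: prod.split)
    with elim show ?case by (simp add: case_prod_beta)
  qed
  from MM.AE_pair[OF this] show ?thesis unfolding M_def by simp
qed

section \<open>Unitary equivalence\<close>

lemma V_op_eq: "V_op \<xi> x = \<xi> (unshift x)"
  by (simp add: V_op_def inv_shift unshift_def)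

lemma mult_unit_vec_eqI:
  fixes A B :: "complex mat"
  assumes "A \<in> carrier_mat n n" "B \<in> carrier_mat n n"
    and "\<And>j. j < n \<Longrightarrow> A *\<^sub>v unit_vec n j = B *\<^sub>v unit_vec n j"
  shows "A = B"
proof (rule eq_matI)
  fix i j assume "i < dim_row B" "j < dim_col B"
  then have ij: "i < n" "j < n" using assms by auto
  have "(A *\<^sub>v unit_vec n j) $ i = (B *\<^sub>v unit_vec n j) $ i" using assms(3) ij by simp
  then show "A $$ (i, j) = B $$ (i, j)" using ij assms(1,2) by simp
qed (use assms in auto)

text \<open>Moving \<open>V_op\<close> past the adjoint of \<open>\<zeta>\<close> evaluates that
  adjoint at \<open>unshift x\<close>, so both operators become a matrix multiplication applied to
  \<open>\<xi> (unshift x)\<close>. The matrices are compared on constant unit vector functions,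
  which are square integrable because the measure is finite, and unitarity moves the adjoint to the
  other side.\<close>

lemma unitarily_equiv_iff:
  assumes N: "prob_space N"
    and F: "\<And>x. x \<in> space (bernoulli N) \<Longrightarrow> F x \<in> carrier_mat n n"
    and G: "\<And>x. x \<in> space (bernoulli N) \<Longrightarrow> G x \<in> carrier_mat n n"
  shows "unitarily_equiv (bernoulli N) n F G \<longleftrightarrow>
    (\<exists>\<zeta>. unitary_Linf (bernoulli N) n \<zeta> \<and> (AE x in bernoulli N. F x * \<zeta> (unshift x) = \<zeta> x * G x))"
proof -
  let ?M = "bernoulli N"
  interpret M: prob_space ?M using N by (rule prob_space_bernoulli)
  note sh = measurable_unshift[of N] distr_unshift[OF N]
  have "op_eq ?M n (mult_op F \<circ> V_op)
       (mult_op \<zeta> \<circ> (mult_op G \<circ> V_op) \<circ> mult_op (\<lambda>x. mat_adjoint (\<zeta> x))) \<longleftrightarrow>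
      (AE x in ?M. F x * \<zeta> (unshift x) = \<zeta> x * G x)" (is "?L \<longleftrightarrow> ?R")
    if \<zeta>: "unitary_Linf ?M n \<zeta>" for \<zeta>
  proof -
    have car: "\<zeta> x \<in> carrier_mat n n" if "x \<in> space ?M" for x
      using \<zeta> that by (auto simp: unitary_Linf_def Linf_mat_def)
    \<comment> \<open>Unitarity holds only almost everywhere, and the factor to be cancelled sits at
      \<open>unshift x\<close>; measure preservation carries the property there.\<close>
    have "AE x in ?M. unitary_mat n (\<zeta> x)"
      using \<zeta> car unfolding unitary_Linf_def unitary_mat_def by (auto elim!: AE_mp)
    from AE_measure_preserving[OF sh this]
    have uni: "AE x in ?M. unitary_mat n (\<zeta> (unshift x))" .
    have expand: "(mult_op \<zeta> \<circ> (mult_op G \<circ> V_op) \<circ> mult_op (\<lambda>x. mat_adjoint (\<zeta> x))) \<xi> x =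
        (\<zeta> x * G x * mat_adjoint (\<zeta> (unshift x))) *\<^sub>v \<xi> (unshift x)"
      if "x \<in> space ?M" "\<xi> (unshift x) \<in> carrier_vec n" for \<xi> x
    proof -
      have "\<zeta> (unshift x) \<in> carrier_mat n n"
        using that measurable_space[OF sh(1)] by (intro car) auto
      then have "mat_adjoint (\<zeta> (unshift x)) \<in> carrier_mat n n" by auto
      then show ?thesis
        using that car[OF that(1)] G[OF that(1)]
        by (simp add: mult_op_def V_op_eq assoc_mult_mat_vec[of _ n n _ n])
    qed
    show ?thesis
    proof
      assume ?L
      have "AE x in ?M. F x *\<^sub>v unit_vec n j =
          (\<zeta> x * G x * mat_adjoint (\<zeta> (unshift x))) *\<^sub>v unit_vec n j" if "j < n" for j
      proof -
        have "(\<lambda>_. unit_vec n j) \<in> L2_vec ?M n"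
          by (auto simp: L2_vec_def)
        with \<open>?L\<close> have "AE x in ?M. (mult_op F \<circ> V_op) (\<lambda>_. unit_vec n j) x =
          (mult_op \<zeta> \<circ> (mult_op G \<circ> V_op) \<circ> mult_op (\<lambda>x. mat_adjoint (\<zeta> x))) (\<lambda>_. unit_vec n j) x"
          unfolding op_eq_def by blast
        then show ?thesis
        proof (rule AE_mp, intro AE_I2 impI)
          fix x assume x: "x \<in> space ?M" and h: "(mult_op F \<circ> V_op) (\<lambda>_. unit_vec n j) x =
            (mult_op \<zeta> \<circ> (mult_op G \<circ> V_op) \<circ> mult_op (\<lambda>x. mat_adjoint (\<zeta> x))) (\<lambda>_. unit_vec n j) x"
          show "F x *\<^sub>v unit_vec n j = (\<zeta> x * G x * mat_adjoint (\<zeta> (unshift x))) *\<^sub>v unit_vec n j"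
            using h expand[OF x, of "\<lambda>_. unit_vec n j"] by (simp add: mult_op_def V_op_eq)
        qed
      qed
      then have "AE x in ?M. \<forall>j\<in>{..<n}. F x *\<^sub>v unit_vec n j =
          (\<zeta> x * G x * mat_adjoint (\<zeta> (unshift x))) *\<^sub>v unit_vec n j"
        by (intro AE_finite_allI) auto
      then show ?R
        using uni
      proof (rule AE_mp[OF AE_conjI], intro AE_I2 impI)
        fix x assume x: "x \<in> space ?M" and
          h: "(\<forall>j\<in>{..<n}. F x *\<^sub>v unit_vec n j =
            (\<zeta> x * G x * mat_adjoint (\<zeta> (unshift x))) *\<^sub>v unit_vec n j) \<and> unitary_mat n (\<zeta> (unshift x))"
        then have c: "\<zeta> (unshift x) \<in> carrier_mat n n" "mat_adjoint (\<zeta> (unshift x)) \<in> carrier_mat n n"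
          and e: "mat_adjoint (\<zeta> (unshift x)) * \<zeta> (unshift x) = 1\<^sub>m n"
          by (auto simp: unitary_mat_def)
        have "F x = \<zeta> x * G x * mat_adjoint (\<zeta> (unshift x))"
          using h F[OF x] G[OF x] car[OF x] c
          by (intro mult_unit_vec_eqI[of _ n]) (simp_all del: assoc_mult_mat)
        then show "F x * \<zeta> (unshift x) = \<zeta> x * G x"
          using c e F[OF x] G[OF x] car[OF x] by (simp add: assoc_mult_mat[of _ n n _ n _ n])
      qed
    next
      assume ?R
      show ?L unfolding op_eq_def
      proof
        fix \<xi> assume \<xi>: "\<xi> \<in> L2_vec ?M n"
        show "AE x in ?M. (mult_op F \<circ> V_op) \<xi> x =
          (mult_op \<zeta> \<circ> (mult_op G \<circ> V_op) \<circ> mult_op (\<lambda>x. mat_adjoint (\<zeta> x))) \<xi> x"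
          using \<open>?R\<close> uni
        proof (rule AE_mp[OF AE_conjI], intro AE_I2 impI)
          fix x assume x: "x \<in> space ?M" and
            h: "F x * \<zeta> (unshift x) = \<zeta> x * G x \<and> unitary_mat n (\<zeta> (unshift x))"
          then have c: "\<zeta> (unshift x) \<in> carrier_mat n n" "mat_adjoint (\<zeta> (unshift x)) \<in> carrier_mat n n"
            and e: "\<zeta> (unshift x) * mat_adjoint (\<zeta> (unshift x)) = 1\<^sub>m n"
            by (auto simp: unitary_mat_def)
          have v: "\<xi> (unshift x) \<in> carrier_vec n"
            using \<xi> measurable_space[OF sh(1) x] by (auto simp: L2_vec_def)
          have "F x * \<zeta> (unshift x) * mat_adjoint (\<zeta> (unshift x)) = F x"
            using c e F[OF x] by (simp add: assoc_mult_mat[of _ n n _ n _ n])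
          then show "(mult_op F \<circ> V_op) \<xi> x =
            (mult_op \<zeta> \<circ> (mult_op G \<circ> V_op) \<circ> mult_op (\<lambda>x. mat_adjoint (\<zeta> x))) \<xi> x"
            unfolding expand[OF x, of \<xi>, OF v] using h by (simp add: mult_op_def V_op_eq)
        qed
      qed
    qed
  qed
  then show ?thesis unfolding unitarily_equiv_def by blast
qed

section \<open>The two values of W and their simultaneous conjugation\<close>

lemma W_eq:
  assumes "x \<in> seq_space L"
  shows "W n L C1 l x = (if x 0 \<in> C1 then fst l \<cdot>\<^sub>m mat_adjoint (u_mat n) else snd l \<cdot>\<^sub>m mat_adjoint (v_mat n))"
  using assms
  by (intro eq_matI) (auto simp: W_def tensor_def cyl_def u_mat_def v_mat_def)

text \<open>Unitary equivalence through a constant function with value \<open>S\<close>: the two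
  equations are the intertwining relation on C and on D.\<close>

definition conj_equiv :: "nat \<Rightarrow> complex \<times> complex \<Rightarrow> complex \<times> complex \<Rightarrow> bool" where
  "conj_equiv n l l' \<longleftrightarrow> (\<exists>S. unitary_mat n S \<and>
     (fst l \<cdot>\<^sub>m mat_adjoint (u_mat n)) * S = S * (fst l' \<cdot>\<^sub>m mat_adjoint (u_mat n)) \<and>
     (snd l \<cdot>\<^sub>m mat_adjoint (v_mat n)) * S = S * (snd l' \<cdot>\<^sub>m mat_adjoint (v_mat n)))"

lemma conj_equiv_refl: "conj_equiv n l l"
  unfolding conj_equiv_def
proof (intro exI conjI)
  show "unitary_mat n (1\<^sub>m n)"
  proof (rule unitary_matI)
    have "mat_adjoint (1\<^sub>m n) = (1\<^sub>m n :: complex mat)"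
      by (intro eq_matI) (auto simp: index_adjoint)
    then show "1\<^sub>m n * mat_adjoint (1\<^sub>m n) = (1\<^sub>m n :: complex mat)" by simp
  qed simp
qed auto

lemma intertwine_mult:
  fixes A B C :: "'a :: semiring_1 mat"
  assumes "A \<in> carrier_mat n n" "B \<in> carrier_mat n n" "C \<in> carrier_mat n n"
    "S \<in> carrier_mat n n" "T \<in> carrier_mat n n"
    and "A * S = S * B" "B * T = T * C"
  shows "A * (S * T) = S * T * C"
proof -
  have "A * (S * T) = A * S * T" using assms(1-5) by (simp add: assoc_mult_mat[of _ n n _ n _ n])
  also have "\<dots> = S * (B * T)"
    unfolding assms(6) using assms(1-5) by (simp add: assoc_mult_mat[of _ n n _ n _ n])
  also have "\<dots> = S * T * C"
    unfolding assms(7) using assms(1-5) by (simp add: assoc_mult_mat[of _ n n _ n _ n])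
  finally show ?thesis .
qed

lemma conj_equiv_trans:
  assumes "conj_equiv n l l'" "conj_equiv n l' l''"
  shows "conj_equiv n l l''"
proof -
  obtain S T where S: "unitary_mat n S"
     "(fst l \<cdot>\<^sub>m mat_adjoint (u_mat n)) * S = S * (fst l' \<cdot>\<^sub>m mat_adjoint (u_mat n))"
     "(snd l \<cdot>\<^sub>m mat_adjoint (v_mat n)) * S = S * (snd l' \<cdot>\<^sub>m mat_adjoint (v_mat n))"
    and T: "unitary_mat n T"
     "(fst l' \<cdot>\<^sub>m mat_adjoint (u_mat n)) * T = T * (fst l'' \<cdot>\<^sub>m mat_adjoint (u_mat n))"
     "(snd l' \<cdot>\<^sub>m mat_adjoint (v_mat n)) * T = T * (snd l'' \<cdot>\<^sub>m mat_adjoint (v_mat n))"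
    using assms unfolding conj_equiv_def by auto
  have c: "S \<in> carrier_mat n n" "T \<in> carrier_mat n n"
    "z \<cdot>\<^sub>m mat_adjoint (u_mat n) \<in> carrier_mat n n" "z \<cdot>\<^sub>m mat_adjoint (v_mat n) \<in> carrier_mat n n" for z
    using S T by (auto simp: unitary_mat_def)
  show ?thesis unfolding conj_equiv_def
    using intertwine_mult[OF c(3,3,3,1,2) S(2) T(2)] intertwine_mult[OF c(4,4,4,1,2) S(3) T(3)]
      unitary_mat_mult[OF S(1) T(1)] by blast
qed

text \<open>The witness is v: it commutes with its own adjoint and passes the adjoint of u at the
  cost of a factor \<omega>.\<close>

lemma conj_equiv_v: "conj_equiv n (a, b) (\<omega> n * a, b)"
proof -
  have c: "mat_adjoint (u_mat n) \<in> carrier_mat n n" "mat_adjoint (v_mat n) \<in> carrier_mat n n" by auto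
  have "v_mat n * mat_adjoint (v_mat n) = mat_adjoint (v_mat n) * v_mat n"
    using unitary_v_mat by (simp add: unitary_mat_def)
  then show ?thesis
    unfolding conj_equiv_def using c unitary_v_mat
    by (intro exI[of _ "v_mat n"])
      (simp add: mult_smult_assoc_mat[of _ n n _ n] mult_smult_distrib[of _ n n _ n] adjoint_u_mult_v
        smult_smult_mat_mult mult.commute)
qed

text \<open>The witness is u. The factor is the conjugate of \<omega>, since u has to pass the
  adjoint of v.\<close>

lemma conj_equiv_u: "conj_equiv n (a, b) (a, cnj (\<omega> n) * b)"
proof -
  have c: "mat_adjoint (u_mat n) \<in> carrier_mat n n" "mat_adjoint (v_mat n) \<in> carrier_mat n n" by auto
  have "u_mat n * mat_adjoint (u_mat n) = mat_adjoint (u_mat n) * u_mat n"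
    using unitary_u_mat by (simp add: unitary_mat_def)
  then show ?thesis
    unfolding conj_equiv_def using c unitary_u_mat
    by (intro exI[of _ "u_mat n"])
      (simp add: mult_smult_assoc_mat[of _ n n _ n] mult_smult_distrib[of _ n n _ n] adjoint_v_mult_u
        smult_smult_mat_mult mult.commute)
qed

lemma conj_equiv_powers: "conj_equiv n (a, b) (\<omega> n ^ j * a, cnj (\<omega> n) ^ k * b)"
proof -
  have "conj_equiv n (a, b) (\<omega> n ^ j * a, b)"
  proof (induction j)
    case 0
    show ?case by (simp add: conj_equiv_refl)
  next
    case (Suc j)
    from conj_equiv_trans[OF this conj_equiv_v] show ?case by (simp add: mult.assoc)
  qed
  moreover have "conj_equiv n (c, b) (c, cnj (\<omega> n) ^ k * b)" for c
  proof (induction k)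
    case 0
    show ?case by (simp add: conj_equiv_refl)
  next
    case (Suc k)
    from conj_equiv_trans[OF this conj_equiv_u] show ?case by (simp add: mult.assoc)
  qed
  ultimately show ?thesis by (rule conj_equiv_trans)
qed

lemma root_of_unity_eq_omega_power:
  assumes "n > 0" "z ^ n = 1"
  obtains k where "z = \<omega> n ^ k"
proof -
  from Complex.bij_betw_roots_unity[OF assms(1)] assms(2)
  obtain k where "z = cis (2 * pi * real k / real n)"
    by (auto simp: bij_betw_def)
  then have "z = \<omega> n ^ k"
    by (simp add: cis_conv_exp \<omega>_def exp_of_nat_mult[symmetric] field_simps)
  then show thesis by (rule that)
qed

lemma conj_equivI:
  assumes n: "n > 0" and "a \<noteq> 0" "b \<noteq> 0" "a ^ n = a' ^ n" "b ^ n = b' ^ n"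
  shows "conj_equiv n (a, b) (a', b')"
proof -
  have "(a' / a) ^ n = 1" "(b' / b) ^ n = 1"
    using assms(2,3) by (simp_all add: power_divide flip: assms(4,5))
  \<comment> \<open>The second components can be changed by powers of the conjugate of \<omega>, so
    the quotient there is conjugated before it is written as a power of \<omega>.\<close>
  then have "(a' / a) ^ n = 1" "(cnj (b' / b)) ^ n = 1"
    by (metis complex_cnj_one complex_cnj_power)+
  then obtain j k where jk: "a' / a = \<omega> n ^ j" "cnj (b' / b) = \<omega> n ^ k"
    using root_of_unity_eq_omega_power[OF n] by metis
  then have "b' / b = cnj (\<omega> n) ^ k" by (metis complex_cnj_cnj complex_cnj_power)
  with jk(1) have "a' = \<omega> n ^ j * a" "b' = cnj (\<omega> n) ^ k * b"
    using assms by (auto simp: field_simps)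
  then show ?thesis using conj_equiv_powers by simp
qed

section \<open>From a constant intertwiner to equality of n-th powers\<close>

lemma bernoulli_coord_not_null:
  assumes "prob_space N" and A: "A \<in> sets N" "emeasure N A > 0" and P: "AE x in bernoulli N. P x"
  obtains x where "x \<in> space (bernoulli N)" "x 0 \<in> A" "P x"
proof (rule ccontr)
  interpret N: prob_space N by fact
  interpret P: product_prob_space "\<lambda>_. N" "UNIV :: int set" by unfold_locales
  assume "\<not> thesis"
  \<comment> \<open>Without such a point, coordinate 0 would almost surely avoid \<open>A\<close>,
    whereas the cylinder over \<open>A\<close> has the positive mass of \<open>A\<close>.\<close>
  with that have "AE x in bernoulli N. x 0 \<notin> A"
    using P by (auto elim!: AE_mp)
  moreover have "{x \<in> space (bernoulli N). x 0 \<in> A} \<in> sets (bernoulli N)"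
    unfolding bernoulli_def using A by measurable
  ultimately have "emeasure (bernoulli N) {x \<in> space (bernoulli N). x 0 \<in> A} = 0"
    by (subst (asm) AE_iff_measurable[of "{x \<in> space (bernoulli N). x 0 \<in> A}"]) auto
  then show False
    using P.emeasure_PiM_Collect_single[of 0 A] A by (simp add: bernoulli_def)
qed

text \<open>Take determinants: scaling an n by n matrix by \<open>c\<close> contributes
  \<open>c ^ n\<close>, and the nonzero determinants of \<open>Z\<close> and \<open>U\<close>
  cancel.\<close>

lemma power_eq_if_smult_intertwine:
  assumes "Z \<in> carrier_mat n n" "det Z \<noteq> 0" "unitary_mat n U"
    "(c \<cdot>\<^sub>m U) * Z = Z * (c' \<cdot>\<^sub>m U)"
  shows "c ^ n = c' ^ n"
proof -
  have U: "U \<in> carrier_mat n n" using assms by (simp add: unitary_mat_def)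
  have "det ((c \<cdot>\<^sub>m U) * Z) = det (Z * (c' \<cdot>\<^sub>m U))" using assms by simp
  then have "c ^ n * det U * det Z = det Z * (c' ^ n * det U)"
    using U assms(1) by (simp add: det_mult[of _ n])
  then show ?thesis using assms(2) det_unitary_mat_nonzero[OF assms(3)] by auto
qed

theorem proposition4p8:
  fixes L C1 :: "'l set" and \<mu>1 :: "'l measure" and n :: nat
    and l l' :: "complex \<times> complex"
  assumes "finite L" and "card L > 1"
    and "prob_space \<mu>1" and "space \<mu>1 = L" and "sets \<mu>1 = Pow L"
    and "\<And>a. a \<in> L \<Longrightarrow> measure \<mu>1 {a} > 0"
    and "n > 1"
    and "C1 \<noteq> {}" and "C1 \<subset> L"
    and "cmod (fst l) = 1" and "cmod (snd l) = 1"
    and "cmod (fst l') = 1" and "cmod (snd l') = 1"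
  shows "unitarily_equiv (bernoulli \<mu>1) n (W n L C1 l) (W n L C1 l') \<longleftrightarrow>
         fst l ^ n = fst l' ^ n \<and> snd l ^ n = snd l' ^ n"
proof -
  let ?M = "bernoulli \<mu>1"
  let ?A = "\<lambda>l a. if a \<in> C1 then fst l \<cdot>\<^sub>m mat_adjoint (u_mat n) else snd l \<cdot>\<^sub>m mat_adjoint (v_mat n)"
  interpret \<mu>1: prob_space \<mu>1 by fact
  interpret M: prob_space ?M by (rule prob_space_bernoulli) fact
  have spM: "space ?M = seq_space L" using assms(4) by (simp add: space_bernoulli)
  have W: "W n L C1 l x = ?A l (x 0)" if "x \<in> space ?M" for l x
    using that by (simp add: W_eq spM)
  have car: "?A l a \<in> carrier_mat n n" for l a by auto
  have uni: "unitary_mat n (?A l a)" and sub: "doubly_substochastic n (?A l a)"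
    if "cmod (fst l) = 1" "cmod (snd l) = 1" for l a
    using that
    by (auto intro!: unitary_mat_smult unitary_mat_adjoint unitary_u_mat unitary_v_mat
      doubly_substochastic_smult doubly_substochastic_adjoint
      doubly_substochastic_u_mat doubly_substochastic_v_mat)
  have equiv: "unitarily_equiv ?M n (W n L C1 l) (W n L C1 l') \<longleftrightarrow>
    (\<exists>\<zeta>. unitary_Linf ?M n \<zeta> \<and> (AE x in ?M. W n L C1 l x * \<zeta> (unshift x) = \<zeta> x * W n L C1 l' x))"
    by (rule unitarily_equiv_iff) (use assms(3) car in \<open>simp_all only: W\<close>)
  have AEW: "(AE x in ?M. W n L C1 l x * \<zeta> (unshift x) = \<zeta> x * W n L C1 l' x) \<longleftrightarrow>
    (AE x in ?M. ?A l (x 0) * \<zeta> (unshift x) = \<zeta> x * ?A l' (x 0))" for \<zeta>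
    by (rule AE_cong) (simp only: W)
  show ?thesis unfolding equiv AEW
  proof
    assume "\<exists>\<zeta>. unitary_Linf ?M n \<zeta> \<and> (AE x in ?M. ?A l (x 0) * \<zeta> (unshift x) = \<zeta> x * ?A l' (x 0))"
    then obtain \<zeta> where \<zeta>: "unitary_Linf ?M n \<zeta>"
      and eq: "AE x in ?M. ?A l (x 0) * \<zeta> (unshift x) = \<zeta> x * ?A l' (x 0)" by blast
    have "AE x in ?M. AE y in ?M. \<zeta> x = \<zeta> y"
      by (rule intertwiner_AE_const[OF assms(3) _ _ _ _ _ eq])
        (use \<zeta> assms in \<open>auto simp only: unitary_Linf_def intro!: uni sub\<close>)
    moreover have "AE x in ?M. unitary_mat n (\<zeta> x)"
      using \<zeta> unfolding unitary_Linf_def unitary_mat_def Linf_mat_def by (auto elim!: AE_mp)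
    ultimately have "AE x in ?M. (AE y in ?M. \<zeta> x = \<zeta> y) \<and> unitary_mat n (\<zeta> x)" by (rule AE_conjI)
    \<comment> \<open>In a probability space an almost sure property holds at some point; the value
      of \<open>\<zeta>\<close> at this point is both unitary and the almost sure constant
      \<open>Z\<close>.\<close>
    from eventually_happens[OF this] M.ae_filter_bot obtain x
      where "AE y in ?M. \<zeta> x = \<zeta> y" and u: "unitary_mat n (\<zeta> x)" by auto
    define Z where "Z = \<zeta> x"
    have Z: "AE y in ?M. \<zeta> y = Z" using \<open>AE y in ?M. \<zeta> x = \<zeta> y\<close> unfolding Z_def by auto
    have Z': "Z \<in> carrier_mat n n" "det Z \<noteq> 0"
      using u det_unitary_mat_nonzero[OF u] by (auto simp: Z_def unitary_mat_def)
    \<comment> \<open>\<open>\<zeta>\<close> is replaced by \<open>Z\<close> at x and, because the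
      unshift preserves the measure, also at \<open>unshift x\<close>.\<close>
    have eqZ: "AE x in ?M. ?A l (x 0) * Z = Z * ?A l' (x 0)"
      using eq Z AE_measure_preserving[OF measurable_unshift distr_unshift[OF assms(3)] Z]
      by eventually_elim simp
    \<comment> \<open>Every point of \<open>L\<close> has positive mass. This is applied to
      \<open>C1\<close> and to \<open>L - C1\<close>, nonempty because \<open>C1\<close> is proper,
      so both the u branch and the v branch of the relation are realised at some point.\<close>
    have pos: "emeasure \<mu>1 B > 0" if "B \<subseteq> L" "B \<noteq> {}" for B
    proof -
      obtain b where "b \<in> B" using \<open>B \<noteq> {}\<close> by auto
      then have "0 < emeasure \<mu>1 {b}" using assms(6)[of b] that by (auto simp: \<mu>1.emeasure_eq_measure)
      also have "\<dots> \<le> emeasure \<mu>1 B" using that \<open>b \<in> B\<close> assms(5) by (intro emeasure_mono) auto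
      finally show ?thesis .
    qed
    obtain x where "x 0 \<in> C1" "?A l (x 0) * Z = Z * ?A l' (x 0)"
      by (rule bernoulli_coord_not_null[OF assms(3) _ pos eqZ, of C1]) (use assms(5,8,9) in auto)
    then have 1: "fst l ^ n = fst l' ^ n"
      using Z' by (intro power_eq_if_smult_intertwine[of Z n "mat_adjoint (u_mat n)"])
        (auto intro: unitary_mat_adjoint unitary_u_mat)
    obtain x where "x 0 \<in> L - C1" "?A l (x 0) * Z = Z * ?A l' (x 0)"
      by (rule bernoulli_coord_not_null[OF assms(3) _ pos eqZ, of "L - C1"]) (use assms(5,9) in auto)
    then have 2: "snd l ^ n = snd l' ^ n"
      using Z' by (intro power_eq_if_smult_intertwine[of Z n "mat_adjoint (v_mat n)"])
        (auto intro: unitary_mat_adjoint unitary_v_mat)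
    from 1 2 show "fst l ^ n = fst l' ^ n \<and> snd l ^ n = snd l' ^ n" ..
  next
    assume eq: "fst l ^ n = fst l' ^ n \<and> snd l ^ n = snd l' ^ n"
    have "conj_equiv n (fst l, snd l) (fst l', snd l')"
      by (rule conj_equivI) (use eq assms in auto)
    then obtain S where S: "unitary_mat n S" "\<And>a. ?A l a * S = S * ?A l' a"
      unfolding conj_equiv_def by auto
    \<comment> \<open>The constant function \<open>S\<close> needs one bound common to all entries
      to belong to \<open>Linf_mat\<close>; the entry sum serves.\<close>
    have "cmod (S $$ (i, j)) \<le> entry_sum n S" if "i < n" "j < n" for i j
    proof -
      have "cmod (S $$ (i, j)) \<le> (\<Sum>j<n. cmod (S $$ (i, j)))"
        using that by (intro member_le_sum) auto
      also have "\<dots> \<le> entry_sum n S"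
        unfolding entry_sum_def using that
        by (intro member_le_sum[of i "{..<n}" "\<lambda>i. \<Sum>j<n. cmod (S $$ (i, j))"]) (auto simp: sum_nonneg)
      finally show ?thesis .
    qed
    then have "unitary_Linf ?M n (\<lambda>_. S)"
      using S(1) unfolding unitary_Linf_def unitary_mat_def Linf_mat_def by auto
    with S(2) show "\<exists>\<zeta>. unitary_Linf ?M n \<zeta> \<and> (AE x in ?M. ?A l (x 0) * \<zeta> (unshift x) = \<zeta> x * ?A l' (x 0))"
      by (intro exI[of _ "\<lambda>_. S"]) auto
  qed
qed

end
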